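(* Let $(G,X)$ be a flow with $X$ compact and not connected, and with $G$ compactly generated. If $(G,X)$ is distal, then $(G,X)$ has a non-trivial factor $(G,Y)$ that is equicontinuous and pointwise regularly almost periodic.
   Context: A Hausdorff para-topological group is a group with a Hausdorff topology for which multiplication $G\times G\to G$ is jointly continuous (inversion need not be continuous). A flow $(G,X)$ with compact phase space consists of a Hausdorff para-topological group $G$, a compact Hausdorff space $X$ (with its unique uniformity $\mathscr{U}$), and a jointly continuous map $G\times X\to X$, $(t,x)\mapsto tx$, with $ex=x$ and $(st)x=s(tx)$. $G$ is compactly generated if there is a compact $\Gamma\subseteq G$ with $e\in\Gamma=\Gamma^{-1}$ and $G=\bigcup_{r\ge1}\Gamma^r$. $(G,X)$ is distal if for all $x\ne y$ in $X$ the closure $\overline{G(x,y)}$ in $X\times X$ of the orbit $\{(gx,gy):g\in G\}$ is disjoint from the diagonal $\Delta_X$. A factor of $(G,X)$ is a flow $(G,Y)$ together with a continuous $G$-equivariant surjection $X\to Y$; it is non-trivial if $Y$ is not a singleton. A subset $A\subseteq G$ is syndetic if $G=K^{-1}A$ for some compact $K\subseteq G$. A point $y$ is regularly almost periodic if for every neighborhood $U$ of $y$ the set $\{t\in G: ty\in U\}$ contains a syndetic normal subgroup of $G$; the flow is pointwise regularly almost periodic if every point is. A flow is equicontinuous if for every point $y$ and every index $\varepsilon$ of the uniformity there is a neighborhood $U$ of $y$ with $gU\subseteq\varepsilon[gy]$ for all $g\in G$, where $\varepsilon[z]=\{w:(z,w)\in\varepsilon\}$. *)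

theory Defs
  imports "HOL-Analysis.Analysis" "HOL-Algebra.Coset"
begin

section \<open>Uniformities\<close>

text \<open>
  The library provides uniform spaces only as a type class. Here a uniformity on a set is given by
  its family of indices (entourages), so that it can be used together with \<^typ>\<open>'x topology\<close>.
\<close>

definition uniformity_on :: "'x set \<Rightarrow> ('x \<times> 'x) set set \<Rightarrow> bool" where
  "uniformity_on S \<U> \<longleftrightarrow>
     \<U> \<noteq> {} \<and>
     (\<forall>\<epsilon>\<in>\<U>. \<epsilon> \<subseteq> S \<times> S \<and> Id_on S \<subseteq> \<epsilon>) \<and>
     (\<forall>\<epsilon>\<in>\<U>. \<forall>\<delta>. \<epsilon> \<subseteq> \<delta> \<and> \<delta> \<subseteq> S \<times> S \<longrightarrow> \<delta> \<in> \<U>) \<and>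
     (\<forall>\<epsilon>\<in>\<U>. \<forall>\<delta>\<in>\<U>. \<epsilon> \<inter> \<delta> \<in> \<U>) \<and>
     (\<forall>\<epsilon>\<in>\<U>. \<epsilon>\<inverse> \<in> \<U>) \<and>
     (\<forall>\<epsilon>\<in>\<U>. \<exists>\<delta>\<in>\<U>. \<delta> O \<delta> \<subseteq> \<epsilon>)"

definition compatible_uniformity :: "'x topology \<Rightarrow> ('x \<times> 'x) set set \<Rightarrow> bool" where
  "compatible_uniformity X \<U> \<longleftrightarrow>
     uniformity_on (topspace X) \<U> \<and>
     (\<forall>W. openin X W \<longleftrightarrow> W \<subseteq> topspace X \<and> (\<forall>x\<in>W. \<exists>\<epsilon>\<in>\<U>. \<epsilon> `` {x} \<subseteq> W))"

text \<open>Meaningful for compact Hausdorff spaces, where existence and uniqueness are proved below.\<close>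

definition the_uniformity :: "'x topology \<Rightarrow> ('x \<times> 'x) set set" where
  "the_uniformity X = (THE \<U>. compatible_uniformity X \<U>)"

definition diagonal_nbhds :: "'x topology \<Rightarrow> ('x \<times> 'x) set set" where
  "diagonal_nbhds X =
     {\<epsilon>. \<epsilon> \<subseteq> topspace X \<times> topspace X \<and>
         (\<exists>W. openin (prod_topology X X) W \<and> Id_on (topspace X) \<subseteq> W \<and> W \<subseteq> \<epsilon>)}"

lemma compact_space_finite_subcover:
  assumes "compact_space X" and "\<And>x. x \<in> topspace X \<Longrightarrow> openin X (P x) \<and> x \<in> P x"
  obtains F where "finite F" "F \<subseteq> topspace X" "topspace X \<subseteq> (\<Union>x\<in>F. P x)"
proof -
  have "\<exists>\<F>. finite \<F> \<and> \<F> \<subseteq> P ` topspace X \<and> topspace X \<subseteq> \<Union>\<F>"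
    using assms(1)[unfolded compact_space_alt, rule_format, of "P ` topspace X"] assms(2) by blast
  then obtain \<F> where \<F>: "finite \<F>" "\<F> \<subseteq> P ` topspace X" "topspace X \<subseteq> \<Union>\<F>" by blast
  then obtain F where "F \<subseteq> topspace X" "finite F" "\<F> = P ` F"
    by (meson finite_subset_image)
  then show thesis using \<F> that by blast
qed

lemma uniformity_onD:
  assumes "uniformity_on S \<U>"
  shows "\<U> \<noteq> {}"
    and "\<epsilon> \<in> \<U> \<Longrightarrow> \<epsilon> \<subseteq> S \<times> S"
    and "\<epsilon> \<in> \<U> \<Longrightarrow> x \<in> S \<Longrightarrow> (x, x) \<in> \<epsilon>"
    and "\<epsilon> \<in> \<U> \<Longrightarrow> \<epsilon> \<subseteq> \<delta> \<Longrightarrow> \<delta> \<subseteq> S \<times> S \<Longrightarrow> \<delta> \<in> \<U>"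
    and "\<epsilon> \<in> \<U> \<Longrightarrow> \<delta> \<in> \<U> \<Longrightarrow> \<epsilon> \<inter> \<delta> \<in> \<U>"
    and "\<epsilon> \<in> \<U> \<Longrightarrow> \<epsilon>\<inverse> \<in> \<U>"
    and "\<epsilon> \<in> \<U> \<Longrightarrow> \<exists>\<delta>\<in>\<U>. \<delta> O \<delta> \<subseteq> \<epsilon>"
proof -
  from assms show "\<U> \<noteq> {}" unfolding uniformity_on_def by (elim conjE)
  from assms have 1: "\<forall>\<epsilon>\<in>\<U>. \<epsilon> \<subseteq> S \<times> S \<and> Id_on S \<subseteq> \<epsilon>"
    and 2: "\<forall>\<epsilon>\<in>\<U>. \<forall>\<delta>. \<epsilon> \<subseteq> \<delta> \<and> \<delta> \<subseteq> S \<times> S \<longrightarrow> \<delta> \<in> \<U>"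
    and 3: "\<forall>\<epsilon>\<in>\<U>. \<forall>\<delta>\<in>\<U>. \<epsilon> \<inter> \<delta> \<in> \<U>"
    and 4: "\<forall>\<epsilon>\<in>\<U>. \<epsilon>\<inverse> \<in> \<U>"
    and 5: "\<forall>\<epsilon>\<in>\<U>. \<exists>\<delta>\<in>\<U>. \<delta> O \<delta> \<subseteq> \<epsilon>"
    unfolding uniformity_on_def by - (elim conjE, assumption)+
  show "\<epsilon> \<in> \<U> \<Longrightarrow> \<epsilon> \<subseteq> S \<times> S" using 1 by simp
  show "\<epsilon> \<in> \<U> \<Longrightarrow> x \<in> S \<Longrightarrow> (x, x) \<in> \<epsilon>" using 1 by blast
  show "\<epsilon> \<in> \<U> \<Longrightarrow> \<epsilon> \<subseteq> \<delta> \<Longrightarrow> \<delta> \<subseteq> S \<times> S \<Longrightarrow> \<delta> \<in> \<U>" using 2 by simp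
  show "\<epsilon> \<in> \<U> \<Longrightarrow> \<delta> \<in> \<U> \<Longrightarrow> \<epsilon> \<inter> \<delta> \<in> \<U>" using 3 by simp
  show "\<epsilon> \<in> \<U> \<Longrightarrow> \<epsilon>\<inverse> \<in> \<U>" using 4 by simp
  show "\<epsilon> \<in> \<U> \<Longrightarrow> \<exists>\<delta>\<in>\<U>. \<delta> O \<delta> \<subseteq> \<epsilon>" using 5 by simp
qed

lemma uniformity_on_INT:
  assumes U: "uniformity_on S \<U>" and "finite F" and "\<And>i. i \<in> F \<Longrightarrow> D i \<in> \<U>"
  shows "(S \<times> S) \<inter> (\<Inter>i\<in>F. D i) \<in> \<U>"
  using assms(2,3)
proof (induction F rule: finite_induct)
  case empty
  from uniformity_onD(1)[OF U] obtain \<epsilon> where "\<epsilon> \<in> \<U>" by blast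
  then have "S \<times> S \<in> \<U>" using uniformity_onD(2,4)[OF U] by blast
  then show ?case by simp
next
  case (insert i F)
  then have "D i \<inter> ((S \<times> S) \<inter> (\<Inter>i\<in>F. D i)) \<in> \<U>"
    using uniformity_onD(5)[OF U, of "D i"] by blast
  then show ?case by (simp add: Int_ac)
qed

lemma compatible_uniformity_interior:
  assumes C: "compatible_uniformity X \<U>" and E: "\<epsilon> \<in> \<U>" and x: "x \<in> topspace X"
  obtains P where "openin X P" "x \<in> P" "P \<subseteq> \<epsilon> `` {x}"
proof -
  have U: "uniformity_on (topspace X) \<U>" using C by (simp add: compatible_uniformity_def)
  define P where "P = {y \<in> topspace X. \<exists>\<delta>\<in>\<U>. \<delta> `` {y} \<subseteq> \<epsilon> `` {x}}"
  have "\<exists>\<delta>\<in>\<U>. \<delta> `` {y} \<subseteq> P" if "y \<in> P" for y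
  proof -
    from that obtain \<delta> where d: "\<delta> \<in> \<U>" "\<delta> `` {y} \<subseteq> \<epsilon> `` {x}" unfolding P_def by blast
    then obtain \<eta> where e: "\<eta> \<in> \<U>" "\<eta> O \<eta> \<subseteq> \<delta>" using uniformity_onD(7)[OF U] by blast
    have "\<eta> \<subseteq> topspace X \<times> topspace X" using uniformity_onD(2)[OF U e(1)] .
    have "\<eta> `` {y} \<subseteq> P"
    proof
      fix z assume z: "z \<in> \<eta> `` {y}"
      then have "\<eta> `` {z} \<subseteq> \<delta> `` {y}" using e by blast
      then show "z \<in> P" unfolding P_def
        using d e z \<open>\<eta> \<subseteq> topspace X \<times> topspace X\<close> by blast
    qed
    then show ?thesis using e by blast
  qed
  then have "openin X P" using C unfolding compatible_uniformity_def P_def by blast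
  moreover have "x \<in> P" using E x unfolding P_def by blast
  moreover have "P \<subseteq> \<epsilon> `` {x}"
  proof
    fix z assume "z \<in> P"
    then obtain \<delta> where d: "\<delta> \<in> \<U>" "\<delta> `` {z} \<subseteq> \<epsilon> `` {x}" "z \<in> topspace X" unfolding P_def by blast
    then have "(z, z) \<in> \<delta>" using uniformity_onD(3)[OF U] by blast
    then show "z \<in> \<epsilon> `` {x}" using d by blast
  qed
  ultimately show thesis using that by blast
qed

lemma openin_prod_diagonal_square:
  assumes "openin (prod_topology X X) W" and "Id_on (topspace X) \<subseteq> W" and "x \<in> topspace X"
  obtains V where "openin X V" "x \<in> V" "V \<times> V \<subseteq> W"
proof -
  have "(x, x) \<in> W" using assms by blast
  then obtain A B where "openin X A" "openin X B" "x \<in> A" "x \<in> B" "A \<times> B \<subseteq> W"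
    using assms(1) unfolding openin_prod_topology_alt by meson
  then have "openin X (A \<inter> B)" "x \<in> A \<inter> B" "(A \<inter> B) \<times> (A \<inter> B) \<subseteq> W" by auto
  then show thesis using that by blast
qed

lemma compatible_uniformity_unique:
  assumes X: "compact_space X" and C: "compatible_uniformity X \<U>"
  shows "\<U> = diagonal_nbhds X"
proof
  have U: "uniformity_on (topspace X) \<U>" using C by (simp add: compatible_uniformity_def)
  show "\<U> \<subseteq> diagonal_nbhds X"
  proof
    fix \<epsilon> assume E: "\<epsilon> \<in> \<U>"
    then obtain \<delta> where d: "\<delta> \<in> \<U>" "\<delta> O \<delta> \<subseteq> \<epsilon>" using uniformity_onD(7)[OF U] by blast
    define \<eta> where "\<eta> = \<delta> \<inter> \<delta>\<inverse>"
    have h: "\<eta> \<in> \<U>" unfolding \<eta>_def using uniformity_onD(5,6)[OF U] d(1) by blast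
    have "\<exists>P. openin X P \<and> x \<in> P \<and> P \<subseteq> \<eta> `` {x}" if "x \<in> topspace X" for x
      using compatible_uniformity_interior[OF C h that] by metis
    then obtain P where P: "\<And>x. x \<in> topspace X \<Longrightarrow> openin X (P x) \<and> x \<in> P x \<and> P x \<subseteq> \<eta> `` {x}"
      by metis
    define W where "W = (\<Union>x\<in>topspace X. P x \<times> P x)"
    have "openin (prod_topology X X) W"
      unfolding W_def using P by (intro openin_Union) (auto simp: openin_prod_Times_iff)
    moreover have "Id_on (topspace X) \<subseteq> W" unfolding W_def using P by blast
    moreover have "W \<subseteq> \<epsilon>"
    proof
      fix p assume "p \<in> W"
      then obtain x a b where p: "p = (a, b)" "x \<in> topspace X" "a \<in> P x" "b \<in> P x"
        unfolding W_def by blast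
      then have "(a, x) \<in> \<delta>" "(x, b) \<in> \<delta>" using P[of x] unfolding \<eta>_def by blast+
      then show "p \<in> \<epsilon>" using d p by blast
    qed
    ultimately show "\<epsilon> \<in> diagonal_nbhds X"
      using uniformity_onD(2)[OF U E] unfolding diagonal_nbhds_def by blast
  qed
  show "diagonal_nbhds X \<subseteq> \<U>"
  proof
    fix \<epsilon> assume "\<epsilon> \<in> diagonal_nbhds X"
    then obtain W where W: "openin (prod_topology X X) W" "Id_on (topspace X) \<subseteq> W" "W \<subseteq> \<epsilon>"
      and e: "\<epsilon> \<subseteq> topspace X \<times> topspace X" unfolding diagonal_nbhds_def by blast
    have "\<exists>P D V. openin X P \<and> x \<in> P \<and> D \<in> \<U> \<and> P \<subseteq> D `` {x} \<and> (D O D) `` {x} \<subseteq> V \<and> V \<times> V \<subseteq> W"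
      if x: "x \<in> topspace X" for x
    proof -
      obtain V where V: "openin X V" "x \<in> V" "V \<times> V \<subseteq> W"
        using openin_prod_diagonal_square[OF W(1,2) x] by blast
      then obtain E where E: "E \<in> \<U>" "E `` {x} \<subseteq> V"
        using C unfolding compatible_uniformity_def by blast
      then obtain D where D: "D \<in> \<U>" "D O D \<subseteq> E" using uniformity_onD(7)[OF U] by blast
      obtain P where P: "openin X P" "x \<in> P" "P \<subseteq> D `` {x}"
        using compatible_uniformity_interior[OF C D(1) x] by blast
      have "(D O D) `` {x} \<subseteq> V" using D E by blast
      then show ?thesis using P D V by blast
    qed
    then obtain P D V where PDV: "\<And>x. x \<in> topspace X \<Longrightarrow> openin X (P x) \<and> x \<in> P x \<and> D x \<in> \<U> \<and>
        P x \<subseteq> D x `` {x} \<and> (D x O D x) `` {x} \<subseteq> V x \<and> V x \<times> V x \<subseteq> W"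
      by metis
    obtain F where F: "finite F" "F \<subseteq> topspace X" "topspace X \<subseteq> (\<Union>x\<in>F. P x)"
      using compact_space_finite_subcover[OF X, of P] PDV by blast
    define \<delta> where "\<delta> = (topspace X \<times> topspace X) \<inter> (\<Inter>i\<in>F. D i)"
    have d: "\<delta> \<in> \<U>" unfolding \<delta>_def using uniformity_on_INT[OF U F(1)] PDV F(2) by blast
    have "\<delta> \<subseteq> \<epsilon>"
    proof
      fix p assume p: "p \<in> \<delta>"
      obtain a b where ab: "p = (a, b)" by force
      have a: "a \<in> topspace X" using p ab unfolding \<delta>_def by blast
      then obtain i where i: "i \<in> F" "a \<in> P i" using F by blast
      have Di: "D i \<in> \<U>" using i F PDV by blast
      have "(i, a) \<in> D i" using i F PDV[of i] by blast
      moreover have "(a, b) \<in> D i" using p ab i unfolding \<delta>_def by blast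
      moreover have "(a, a) \<in> D i" using uniformity_onD(3)[OF U Di a] .
      ultimately have "a \<in> (D i O D i) `` {i}" "b \<in> (D i O D i) `` {i}" by blast+
      then have "a \<in> V i" "b \<in> V i" using i F PDV[of i] by blast+
      then show "p \<in> \<epsilon>" using ab W i F PDV[of i] by blast
    qed
    then show "\<epsilon> \<in> \<U>" using uniformity_onD(4)[OF U d] e by blast
  qed
qed

lemma compatible_uniformity_diagonal_nbhds:
  assumes X: "compact_space X" and H: "Hausdorff_space X"
  shows "compatible_uniformity X (diagonal_nbhds X)"
  unfolding compatible_uniformity_def
proof (intro conjI allI)
  let ?S = "topspace X"
  let ?N = "diagonal_nbhds X"
  show "uniformity_on ?S ?N"
    unfolding uniformity_on_def
  proof (intro conjI ballI allI impI)
    have "?S \<times> ?S \<in> ?N"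
      unfolding diagonal_nbhds_def
      using openin_topspace[of "prod_topology X X"] by auto
    then show "?N \<noteq> {}" by blast
  next
    fix \<epsilon> assume "\<epsilon> \<in> ?N"
    then show "\<epsilon> \<subseteq> ?S \<times> ?S" "Id_on ?S \<subseteq> \<epsilon>" unfolding diagonal_nbhds_def by blast+
  next
    fix \<epsilon> \<delta> assume "\<epsilon> \<in> ?N" "\<epsilon> \<subseteq> \<delta> \<and> \<delta> \<subseteq> ?S \<times> ?S"
    then show "\<delta> \<in> ?N" unfolding diagonal_nbhds_def by blast
  next
    fix \<epsilon> \<delta> assume e: "\<epsilon> \<in> ?N" "\<delta> \<in> ?N"
    then obtain W W' where "openin (prod_topology X X) W" "Id_on ?S \<subseteq> W" "W \<subseteq> \<epsilon>"
      "openin (prod_topology X X) W'" "Id_on ?S \<subseteq> W'" "W' \<subseteq> \<delta>"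
      unfolding diagonal_nbhds_def by blast
    then have "openin (prod_topology X X) (W \<inter> W')" "Id_on ?S \<subseteq> W \<inter> W'" "W \<inter> W' \<subseteq> \<epsilon> \<inter> \<delta>"
      by auto
    then show "\<epsilon> \<inter> \<delta> \<in> ?N" using e unfolding diagonal_nbhds_def by blast
  next
    fix \<epsilon> assume e: "\<epsilon> \<in> ?N"
    then obtain W where W: "openin (prod_topology X X) W" "Id_on ?S \<subseteq> W" "W \<subseteq> \<epsilon>"
      unfolding diagonal_nbhds_def by blast
    have "openin (prod_topology X X) (W\<inverse>)"
      unfolding openin_prod_topology_alt
    proof (intro allI impI)
      fix x y assume "(x, y) \<in> W\<inverse>"
      then obtain A B where "openin X A" "openin X B" "y \<in> A" "x \<in> B" "A \<times> B \<subseteq> W"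
        using W(1) unfolding openin_prod_topology_alt by (meson converseD)
      moreover from this have "B \<times> A \<subseteq> W\<inverse>" by blast
      ultimately show "\<exists>U V. openin X U \<and> openin X V \<and> x \<in> U \<and> y \<in> V \<and> U \<times> V \<subseteq> W\<inverse>"
        by blast
    qed
    moreover have "Id_on ?S \<subseteq> W\<inverse>" "W\<inverse> \<subseteq> \<epsilon>\<inverse>" using W by blast+
    ultimately show "\<epsilon>\<inverse> \<in> ?N" using e unfolding diagonal_nbhds_def by blast
  next
    fix \<epsilon> assume e: "\<epsilon> \<in> ?N"
    then obtain W where W: "openin (prod_topology X X) W" "Id_on ?S \<subseteq> W" "W \<subseteq> \<epsilon>"
      unfolding diagonal_nbhds_def by blast
    have nb: "neighbourhood_base_of (closedin X) X"
      using compact_Hausdorff_imp_regular_space[OF X H] neighbourhood_base_of_closedin by blast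
    have "\<exists>V P C. openin X V \<and> V \<times> V \<subseteq> W \<and> openin X P \<and> x \<in> P \<and> closedin X C \<and> P \<subseteq> C \<and> C \<subseteq> V"
      if x: "x \<in> ?S" for x
    proof -
      obtain V where V: "openin X V" "x \<in> V" "V \<times> V \<subseteq> W"
        using openin_prod_diagonal_square[OF W(1,2) x] by blast
      then obtain P C where "openin X P" "closedin X C" "x \<in> P" "P \<subseteq> C" "C \<subseteq> V"
        using nb[unfolded neighbourhood_base_of, rule_format, of V x] by blast
      then show ?thesis using V by blast
    qed
    then obtain V P C where VPC: "\<And>x. x \<in> ?S \<Longrightarrow> openin X (V x) \<and> V x \<times> V x \<subseteq> W \<and>
        openin X (P x) \<and> x \<in> P x \<and> closedin X (C x) \<and> P x \<subseteq> C x \<and> C x \<subseteq> V x"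
      by metis
    obtain F where F: "finite F" "F \<subseteq> ?S" "?S \<subseteq> (\<Union>x\<in>F. P x)"
      using compact_space_finite_subcover[OF X, of P] VPC by blast
    define Q where "Q i = V i \<times> V i \<union> (?S - C i) \<times> (?S - C i)" for i
    define \<delta> where "\<delta> = topspace (prod_topology X X) \<inter> (\<Inter>i\<in>F. Q i)"
    have "openin (prod_topology X X) (Q i)" if "i \<in> F" for i
    proof -
      have "openin X (V i)" "closedin X (C i)" using VPC[of i] that F(2) by blast+
      then have "openin X (?S - C i)" by blast
      with \<open>openin X (V i)\<close> show ?thesis
        unfolding Q_def by (intro openin_Un) (simp_all add: openin_prod_Times_iff)
    qed
    then have "openin (prod_topology X X) \<delta>"
      unfolding \<delta>_def using openin_INT[OF F(1)] by (subst Int_commute) blast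
    moreover have "Id_on ?S \<subseteq> \<delta>"
      unfolding \<delta>_def Q_def using VPC F(2) by auto
    moreover have "\<delta> \<subseteq> ?S \<times> ?S" unfolding \<delta>_def by auto
    ultimately have "\<delta> \<in> ?N" unfolding diagonal_nbhds_def by blast
    moreover have "\<delta> O \<delta> \<subseteq> \<epsilon>"
    proof
      fix p assume "p \<in> \<delta> O \<delta>"
      then obtain a b c where p: "p = (a, c)" "(a, b) \<in> \<delta>" "(b, c) \<in> \<delta>" by blast
      then have "b \<in> ?S" unfolding \<delta>_def by auto
      then obtain i where i: "i \<in> F" "b \<in> P i" using F by blast
      then have "b \<in> C i" using VPC F by blast
      moreover have "(a, b) \<in> Q i" "(b, c) \<in> Q i" using p i unfolding \<delta>_def by blast+
      ultimately have "a \<in> V i" "c \<in> V i" unfolding Q_def by blast+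
      then show "p \<in> \<epsilon>" using p W i F VPC[of i] by blast
    qed
    ultimately show "\<exists>\<delta>\<in>?N. \<delta> O \<delta> \<subseteq> \<epsilon>" by blast
  qed
  fix W
  show "openin X W \<longleftrightarrow> W \<subseteq> ?S \<and> (\<forall>x\<in>W. \<exists>\<epsilon>\<in>?N. \<epsilon> `` {x} \<subseteq> W)"
  proof (intro iffI conjI ballI)
    assume "openin X W" then show "W \<subseteq> ?S" by (rule openin_subset)
  next
    fix x assume W: "openin X W" and x: "x \<in> W"
    then have xS: "x \<in> ?S" using openin_subset by blast
    define \<epsilon> where "\<epsilon> = W \<times> W \<union> (?S - {x}) \<times> (?S - {x})"
    have "closedin X {x}"
      using H xS by (rule closedin_Hausdorff_singleton)
    then have "openin (prod_topology X X) \<epsilon>"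
      unfolding \<epsilon>_def using W by (intro openin_Un) (auto simp: openin_prod_Times_iff)
    moreover have "Id_on ?S \<subseteq> \<epsilon>" "\<epsilon> \<subseteq> ?S \<times> ?S"
      unfolding \<epsilon>_def using x openin_subset[OF W] by auto
    ultimately have "\<epsilon> \<in> ?N" unfolding diagonal_nbhds_def by blast
    moreover have "\<epsilon> `` {x} \<subseteq> W" unfolding \<epsilon>_def by blast
    ultimately show "\<exists>\<epsilon>\<in>?N. \<epsilon> `` {x} \<subseteq> W" by blast
  next
    assume W: "W \<subseteq> ?S \<and> (\<forall>x\<in>W. \<exists>\<epsilon>\<in>?N. \<epsilon> `` {x} \<subseteq> W)"
    show "openin X W"
    proof (subst openin_subopen, intro ballI)
      fix x assume x: "x \<in> W"
      then obtain \<epsilon> where e: "\<epsilon> \<in> ?N" "\<epsilon> `` {x} \<subseteq> W" using W by blast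
      then obtain W' where W': "openin (prod_topology X X) W'" "Id_on ?S \<subseteq> W'" "W' \<subseteq> \<epsilon>"
        unfolding diagonal_nbhds_def by blast
      obtain V where "openin X V" "x \<in> V" "V \<times> V \<subseteq> W'"
        using openin_prod_diagonal_square[OF W'(1,2)] x W by blast
      then show "\<exists>T. openin X T \<and> x \<in> T \<and> T \<subseteq> W" using e W' by blast
    qed
  qed
qed

theorem the_uniformity_compact_Hausdorff:
  assumes "compact_space X" and "Hausdorff_space X"
  shows "compatible_uniformity X (the_uniformity X)"
    and "the_uniformity X = diagonal_nbhds X"
proof -
  show *: "the_uniformity X = diagonal_nbhds X"
    unfolding the_uniformity_def
    using compatible_uniformity_diagonal_nbhds[OF assms] compatible_uniformity_unique[OF assms(1)]
    by (rule the_equality)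
  show "compatible_uniformity X (the_uniformity X)"
    unfolding * by (rule compatible_uniformity_diagonal_nbhds[OF assms])
qed


section \<open>Flows\<close>

locale Hausdorff_paratopological_group = group G
  for G :: "('g, 'm) monoid_scheme" (structure) and T :: "'g topology" +
  assumes topspace_eq_carrier: "topspace T = carrier G"
    and Hausdorff_group: "Hausdorff_space T"
    and continuous_mult: "continuous_map (prod_topology T T) T (\<lambda>(s, t). s \<otimes> t)"

locale compact_flow = Hausdorff_paratopological_group G T
  for G :: "('g, 'm) monoid_scheme" (structure) and T :: "'g topology" +
  fixes X :: "'x topology" and act :: "'g \<Rightarrow> 'x \<Rightarrow> 'x"
  assumes compact_phase: "compact_space X"
    and Hausdorff_phase: "Hausdorff_space X"
    and continuous_act: "continuous_map (prod_topology T X) X (\<lambda>(t, x). act t x)"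
    and act_one: "x \<in> topspace X \<Longrightarrow> act \<one> x = x"
    and act_mult: "s \<in> carrier G \<Longrightarrow> t \<in> carrier G \<Longrightarrow> x \<in> topspace X \<Longrightarrow>
                     act (s \<otimes> t) x = act s (act t x)"

primrec set_power :: "('g, 'm) monoid_scheme \<Rightarrow> 'g set \<Rightarrow> nat \<Rightarrow> 'g set" where
  "set_power G \<Gamma> 0 = {\<one>\<^bsub>G\<^esub>}"
| "set_power G \<Gamma> (Suc r) = \<Gamma> <#>\<^bsub>G\<^esub> set_power G \<Gamma> r"

definition compactly_generated :: "('g, 'm) monoid_scheme \<Rightarrow> 'g topology \<Rightarrow> bool" where
  "compactly_generated G T \<longleftrightarrow>
     (\<exists>\<Gamma>. compactin T \<Gamma> \<and> \<one>\<^bsub>G\<^esub> \<in> \<Gamma> \<and> \<Gamma> = set_inv\<^bsub>G\<^esub> \<Gamma> \<and>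
          carrier G = (\<Union>r\<in>{1..}. set_power G \<Gamma> r))"

definition distal_flow ::
  "('g, 'm) monoid_scheme \<Rightarrow> 'x topology \<Rightarrow> ('g \<Rightarrow> 'x \<Rightarrow> 'x) \<Rightarrow> bool" where
  "distal_flow G X act \<longleftrightarrow>
     (\<forall>x\<in>topspace X. \<forall>y\<in>topspace X. x \<noteq> y \<longrightarrow>
        prod_topology X X closure_of ((\<lambda>g. (act g x, act g y)) ` carrier G)
          \<inter> Id_on (topspace X) = {})"

text \<open>
  Up to isomorphism the points of a factor of \<open>X\<close> are the fibres of the factor map, so quantifying
  over factors with \<open>Y :: 'x set topology\<close> covers all of them.
\<close>

definition flow_factor ::
  "('g, 'm) monoid_scheme \<Rightarrow> 'g topology \<Rightarrow> 'x topology \<Rightarrow> ('g \<Rightarrow> 'x \<Rightarrow> 'x) \<Rightarrow>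
   'y topology \<Rightarrow> ('g \<Rightarrow> 'y \<Rightarrow> 'y) \<Rightarrow> ('x \<Rightarrow> 'y) \<Rightarrow> bool" where
  "flow_factor G T X act Y act' \<pi> \<longleftrightarrow>
     compact_flow G T Y act' \<and>
     continuous_map X Y \<pi> \<and> \<pi> ` topspace X = topspace Y \<and>
     (\<forall>g\<in>carrier G. \<forall>x\<in>topspace X. \<pi> (act g x) = act' g (\<pi> x))"

definition syndetic :: "('g, 'm) monoid_scheme \<Rightarrow> 'g topology \<Rightarrow> 'g set \<Rightarrow> bool" where
  "syndetic G T A \<longleftrightarrow>
     A \<subseteq> carrier G \<and> (\<exists>K. compactin T K \<and> carrier G = set_inv\<^bsub>G\<^esub> K <#>\<^bsub>G\<^esub> A)"

text \<open>Neighborhoods need not be open.\<close>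

definition nbhd_in :: "'x topology \<Rightarrow> 'x \<Rightarrow> 'x set \<Rightarrow> bool" where
  "nbhd_in X x U \<longleftrightarrow> U \<subseteq> topspace X \<and> (\<exists>V. openin X V \<and> x \<in> V \<and> V \<subseteq> U)"

definition regularly_almost_periodic_point ::
  "('g, 'm) monoid_scheme \<Rightarrow> 'g topology \<Rightarrow> 'x topology \<Rightarrow> ('g \<Rightarrow> 'x \<Rightarrow> 'x) \<Rightarrow> 'x \<Rightarrow> bool" where
  "regularly_almost_periodic_point G T X act y \<longleftrightarrow>
     (\<forall>U. nbhd_in X y U \<longrightarrow>
        (\<exists>N. N \<lhd> G \<and> syndetic G T N \<and> N \<subseteq> {t \<in> carrier G. act t y \<in> U}))"

definition pointwise_regularly_almost_periodic ::
  "('g, 'm) monoid_scheme \<Rightarrow> 'g topology \<Rightarrow> 'x topology \<Rightarrow> ('g \<Rightarrow> 'x \<Rightarrow> 'x) \<Rightarrow> bool" where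
  "pointwise_regularly_almost_periodic G T X act \<longleftrightarrow>
     (\<forall>y\<in>topspace X. regularly_almost_periodic_point G T X act y)"

definition equicontinuous_flow ::
  "('g, 'm) monoid_scheme \<Rightarrow> 'x topology \<Rightarrow> ('g \<Rightarrow> 'x \<Rightarrow> 'x) \<Rightarrow> bool" where
  "equicontinuous_flow G X act \<longleftrightarrow>
     (\<forall>y\<in>topspace X. \<forall>\<epsilon>\<in>the_uniformity X. \<exists>U. nbhd_in X y U \<and>
        (\<forall>g\<in>carrier G. act g ` U \<subseteq> \<epsilon> `` {act g y}))"

end

theory Submission
  imports Defs
begin

text \<open>
  Let \<open>A\<close> be a proper nonempty clopen set and let \<open>R\<close> consist of the pairs \<open>(x, y)\<close> such that
  \<open>gx \<in> A \<longleftrightarrow> gy \<in> A\<close> for all \<open>g\<close>. If the closed invariant equivalence relation \<open>R\<close> is open, it has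
  finitely many classes, and the finite discrete flow \<open>X/R\<close> is the required factor: the kernel of its
  action is a normal subgroup of finite index.

  To see that \<open>R\<close> is open, let \<open>R\<^sub>n\<close> be defined like \<open>R\<close>, but with \<open>g\<close> restricted to \<open>\<Gamma>\<^sup>n\<close>; this is
  clopen because \<open>\<Gamma>\<^sup>n\<close> is compact. If \<open>R \<noteq> R\<^sub>n\<close> for all \<open>n\<close>, translating pairs of \<open>R\<^sub>n - R\<close> along
  shortest words that separate them yields by compactness a pair \<open>p\<close> separated by \<open>A\<close> such that the
  orbit of \<open>p\<close> meets every \<open>R\<^sub>m\<close>. Hence the closure of the orbit of \<open>p\<close> meets \<open>R\<close>. In a distal flow the
  enveloping semigroup contains left inverses (the Ellis-Numakura lemma), so that orbit closures in
  \<open>X \<times> X\<close> are minimal. Then \<open>p\<close> itself lies in \<open>R\<close>, a contradiction.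
\<close>

section \<open>Invariant cores of clopen sets\<close>

text \<open>Projection along a compact factor is a closed map. As \<open>T\<close> itself need not
  be compact, the factor is first cut down to the subspace \<open>K\<close>.\<close>

lemma closedin_compact_projection:
  assumes "compactin T K" and "closedin (prod_topology T Z) C"
  shows "closedin Z {z. \<exists>t\<in>K. (t, z) \<in> C}"
proof -
  have "closedin (prod_topology (subtopology T K) Z) (C \<inter> K \<times> topspace Z)"
    unfolding prod_topology_subtopology closedin_subtopology using assms(2) by blast
  moreover have "compact_space (subtopology T K)"
    using assms(1) compactin_subspace by blast
  ultimately have "closedin Z (snd ` (C \<inter> K \<times> topspace Z))"
    using closed_map_snd[of "subtopology T K" Z] unfolding closed_map_def by blast
  moreover have "snd ` (C \<inter> K \<times> topspace Z) = {z. \<exists>t\<in>K. (t, z) \<in> C}"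
    using closedin_subset[OF assms(2)] by force
  ultimately show ?thesis by simp
qed

section \<open>Powers of a generating set\<close>

context group
begin

lemma set_power_subset_carrier:
  assumes "\<Gamma> \<subseteq> carrier G"
  shows "set_power G \<Gamma> r \<subseteq> carrier G"
  using assms by (induction r) (auto simp: set_mult_closed)

text \<open>The recursion of \<open>set_power\<close> peels off letters at the left end only; this
  allows a word to be cut at any position.\<close>

lemma set_power_add:
  assumes "\<Gamma> \<subseteq> carrier G"
  shows "set_power G \<Gamma> (m + n) = set_power G \<Gamma> m <#> set_power G \<Gamma> n"
proof (induction m)
  case 0
  show ?case using set_power_subset_carrier[OF assms, of n] by (force simp: set_mult_def)
next
  case (Suc m)
  then show ?case
    using set_mult_assoc[OF assms set_power_subset_carrier[OF assms] set_power_subset_carrier[OF assms]]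
    by simp
qed

lemma set_power_mono:
  assumes "\<Gamma> \<subseteq> carrier G" and "\<one> \<in> \<Gamma>" and "m \<le> n"
  shows "set_power G \<Gamma> m \<subseteq> set_power G \<Gamma> n"
proof (rule lift_Suc_mono_le[OF _ assms(3)])
  fix r
  show "set_power G \<Gamma> r \<subseteq> set_power G \<Gamma> (Suc r)"
  proof
    fix x assume x: "x \<in> set_power G \<Gamma> r"
    then have "x = \<one> \<otimes> x" using set_power_subset_carrier[OF assms(1)] by fastforce
    then show "x \<in> set_power G \<Gamma> (Suc r)" using assms(2) x by (auto simp: set_mult_def)
  qed
qed

lemma inv_set_power:
  assumes "\<Gamma> \<subseteq> carrier G" and "\<Gamma> = set_inv \<Gamma>" and "x \<in> set_power G \<Gamma> r"
  shows "inv x \<in> set_power G \<Gamma> r"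
  using assms(3)
proof (induction r arbitrary: x)
  case 0
  then show ?case by simp
next
  case (Suc r)
  then obtain a b where ab: "a \<in> \<Gamma>" "b \<in> set_power G \<Gamma> r" "x = a \<otimes> b"
    by (auto simp: set_mult_def)
  have "inv a \<in> \<Gamma>" using assms(2) ab(1) unfolding SET_INV_def by blast
  \<comment> \<open>Inversion reverses a word, so \<open>inv a\<close> moves to the right end, where
    \<open>set_power_add\<close> with last exponent \<open>1\<close> appends it.\<close>
  moreover have "set_power G \<Gamma> 1 = \<Gamma>"
    using assms(1) by (force simp: set_mult_def)
  moreover have "inv x = inv b \<otimes> inv a"
    using ab assms(1) set_power_subset_carrier[OF assms(1)] by (auto intro: inv_mult_group)
  ultimately have "inv x \<in> set_power G \<Gamma> (r + 1)"
    unfolding set_power_add[OF assms(1)] using Suc.IH[OF ab(2)] by (auto simp: set_mult_def)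
  then show ?case by simp
qed

end

context Hausdorff_paratopological_group
begin

lemma compactin_set_power:
  assumes "compactin T \<Gamma>"
  shows "compactin T (set_power G \<Gamma> r)"
proof (induction r)
  case 0
  show ?case using topspace_eq_carrier by (simp add: finite_imp_compactin)
next
  case (Suc r)
  then have "compactin (prod_topology T T) (\<Gamma> \<times> set_power G \<Gamma> r)"
    using assms by (simp add: compactin_Times)
  note image_compactin[OF this continuous_mult]
  moreover have "(\<lambda>(s, t). s \<otimes> t) ` (\<Gamma> \<times> set_power G \<Gamma> r) = set_power G \<Gamma> (Suc r)"
    by (auto simp: set_mult_def)
  ultimately show ?case by simp
qed

end

section \<open>Open and closed conditions on orbits\<close>

context compact_flow
begin

lemma act_closed:
  assumes "g \<in> carrier G" and "x \<in> topspace X"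
  shows "act g x \<in> topspace X"
  using continuous_map_image_subset_topspace[OF continuous_act] assms topspace_eq_carrier
  by auto

lemma act_inv:
  assumes "g \<in> carrier G" and "x \<in> topspace X"
  shows "act (inv g) (act g x) = x" and "act g (act (inv g) x) = x"
  using assms act_mult[of "inv g" g x] act_mult[of g "inv g" x] act_one by simp_all

lemma continuous_map_act_point:
  assumes "g \<in> carrier G"
  shows "continuous_map X X (act g)"
proof -
  have "continuous_map X (prod_topology T X) (\<lambda>x. (g, x))"
    using assms topspace_eq_carrier by (intro continuous_map_pairedI) auto
  from continuous_map_compose[OF this continuous_act] show ?thesis
    by (simp only: o_def case_prod_conv)
qed

lemma continuous_map_act_group:
  assumes "x \<in> topspace X"
  shows "continuous_map T X (\<lambda>g. act g x)"
proof -
  have "continuous_map T (prod_topology T X) (\<lambda>g. (g, x))"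
    using assms by (intro continuous_map_pairedI) auto
  from continuous_map_compose[OF this continuous_act] show ?thesis
    by (simp only: o_def case_prod_conv)
qed

lemma closedin_exists_act:
  assumes "compactin T K" and "closedin X C"
  shows "closedin X {x \<in> topspace X. \<exists>g\<in>K. act g x \<in> C}"
proof -
  let ?C = "{p \<in> topspace (prod_topology T X). (\<lambda>(t, x). act t x) p \<in> C}"
  have "closedin (prod_topology T X) ?C"
    using continuous_act assms(2) by (rule closedin_continuous_map_preimage)
  note closedin_compact_projection[OF assms(1) this]
  moreover have "{x. \<exists>g\<in>K. (g, x) \<in> ?C} = {x \<in> topspace X. \<exists>g\<in>K. act g x \<in> C}"
    using compactin_subset_topspace[OF assms(1)] by auto
  ultimately show ?thesis by simp
qed

text \<open>Compactness of \<open>K\<close> turns a possibly infinite intersection of open sets into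
  an open set: its complement is a projection along \<open>K\<close>.\<close>

lemma openin_forall_act:
  assumes "compactin T K" and "openin X D"
  shows "openin X {x \<in> topspace X. \<forall>g\<in>K. act g x \<in> D}"
proof -
  have "closedin X {x \<in> topspace X. \<exists>g\<in>K. act g x \<in> topspace X - D}"
    using assms by (intro closedin_exists_act closedin_diff closedin_topspace)
  moreover have "{x \<in> topspace X. \<forall>g\<in>K. act g x \<in> D} =
      topspace X - {x \<in> topspace X. \<exists>g\<in>K. act g x \<in> topspace X - D}"
  proof -
    have "act g x \<in> topspace X" if "g \<in> K" "x \<in> topspace X" for g x
      using that compactin_subset_topspace[OF assms(1)] act_closed topspace_eq_carrier by auto
    then show ?thesis by auto
  qed
  ultimately show ?thesis by (simp only: openin_diff openin_topspace)
qed

lemma closedin_forall_act: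
  assumes "K \<subseteq> carrier G" and "closedin X D"
  shows "closedin X {x \<in> topspace X. \<forall>g\<in>K. act g x \<in> D}"
\<comment> \<open>For empty \<open>K\<close> the set is the whole space, whereas the intersection
  over an empty family would be \<open>UNIV\<close>.\<close>
proof (cases "K = {}")
  case False
  have "closedin X (\<Inter>g\<in>K. {x \<in> topspace X. act g x \<in> D})"
    using assms False
    by (intro closedin_INT closedin_continuous_map_preimage[OF continuous_map_act_point]) auto
  moreover have "(\<Inter>g\<in>K. {x \<in> topspace X. act g x \<in> D}) = {x \<in> topspace X. \<forall>g\<in>K. act g x \<in> D}"
    using False by blast
  ultimately show ?thesis by simp
qed auto

text \<open>Stated for any flow so that it can be applied to the product flow on pairs. The
  assumption \<open>sym\<close> expresses that orbit closures are minimal. The core is the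
  intersection of a decreasing sequence of clopen sets, and the proof shows that the sequence
  reaches it.\<close>

lemma openin_invariant_core:
  assumes gen: "compactly_generated G T"
    and D: "openin X D" "closedin X D"
    and sym: "\<And>x y. x \<in> topspace X \<Longrightarrow> y \<in> X closure_of ((\<lambda>g. act g x) ` carrier G) \<Longrightarrow>
                x \<in> X closure_of ((\<lambda>g. act g y) ` carrier G)"
  shows "openin X {x \<in> topspace X. \<forall>g\<in>carrier G. act g x \<in> D}"
proof -
  from gen obtain \<Gamma> where \<Gamma>: "compactin T \<Gamma>" "\<one> \<in> \<Gamma>" "\<Gamma> = set_inv \<Gamma>"
    and cover: "carrier G = (\<Union>r\<in>{1..}. set_power G \<Gamma> r)"
    unfolding compactly_generated_def by (elim exE conjE)
  let ?P = "set_power G \<Gamma>"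
  have \<Gamma>sub: "\<Gamma> \<subseteq> carrier G"
    using compactin_subset_topspace[OF \<Gamma>(1)] topspace_eq_carrier by simp
  have Psub: "?P r \<subseteq> carrier G" for r using set_power_subset_carrier[OF \<Gamma>sub] .
  have Pcomp: "compactin T (?P r)" for r using compactin_set_power[OF \<Gamma>(1)] .
  have Pmono: "?P m \<subseteq> ?P n" if "m \<le> n" for m n
    using set_power_mono[OF \<Gamma>sub \<Gamma>(2) that] .
  define R where "R n = {x \<in> topspace X. \<forall>g\<in>?P n. act g x \<in> D}" for n
  define R' where "R' = {x \<in> topspace X. \<forall>g\<in>carrier G. act g x \<in> D}"
  have Ropen: "openin X (R n)" and Rclosed: "closedin X (R n)" for n
    unfolding R_def using openin_forall_act[OF Pcomp D(1)] closedin_forall_act[OF Psub D(2)] by - assumption+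
  have Rdec: "R n \<subseteq> R m" if "m \<le> n" for m n
    unfolding R_def using Pmono[OF that] by blast
  have R'_iff: "x \<in> R' \<longleftrightarrow> (\<forall>n. x \<in> R n)" for x
  proof
    show "x \<in> R' \<Longrightarrow> \<forall>n. x \<in> R n" unfolding R_def R'_def using Psub by blast
    assume R: "\<forall>n. x \<in> R n"
    have "act g x \<in> D" if "g \<in> carrier G" for g
    proof -
      obtain r where "g \<in> ?P r" using \<open>g \<in> carrier G\<close> unfolding cover by (elim UN_E)
      then show ?thesis using R unfolding R_def by blast
    qed
    then show "x \<in> R'" using R unfolding R_def R'_def by blast
  qed
  have "\<exists>n. R n = R'"
  proof (rule ccontr)
    assume no_n: "\<not> (\<exists>n. R n = R')"
    then have escape: "\<exists>x. x \<in> R n \<and> x \<notin> R'" for n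
    proof -
      have "R' \<subseteq> R n" "R n \<noteq> R'" using no_n R'_iff by (blast, simp)
      then show ?thesis by blast
    qed
    \<comment> \<open>A point of \<open>Q m\<close> reaches \<open>R m\<close> by a word whose
      length is bounded in terms of \<open>m\<close> alone. This bound makes \<open>Q m\<close>
      closed, so the property survives the passage to a limit point.\<close>
    define Q where "Q m = {y \<in> topspace X. \<exists>c\<in>?P (Suc m). act c y \<in> R m}" for m
    \<comment> \<open>As \<open>m\<close> grows, the words get longer but the target
      \<open>R m\<close> shrinks, so the \<open>Q m\<close> are not visibly nested; finite
      intersections are.\<close>
    define C where "C n = (topspace X - D) \<inter> (\<Inter>m\<in>{..n}. Q m)" for n
    have Qclosed: "closedin X (Q m)" for m
      unfolding Q_def using closedin_exists_act[OF Pcomp Rclosed] .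
    have "(\<Inter>n. C n) \<noteq> {}"
    proof (rule compact_space_imp_nest[OF compact_phase])
      show "closedin X (C n)" for n
        unfolding C_def using D Qclosed by (intro closedin_Int closedin_INT) auto
      show "decseq C" 
        unfolding decseq_def C_def by (intro allI impI Int_mono order_refl INT_anti_mono) auto
      show "C n \<noteq> {}" for n
      proof -
        obtain x where x: "x \<in> R n" "x \<notin> R'" using escape by blast
        \<comment> \<open>The least length of a word that moves \<open>x\<close> out of
          \<open>D\<close>. It exceeds \<open>n\<close> because \<open>x\<close> lies in
          \<open>R n\<close>.\<close>
        define r where "r = (LEAST r. x \<notin> R r)"
        have "x \<notin> R r" 
          unfolding r_def by (rule LeastI_ex) (use x(2) R'_iff in simp)
        have least: "x \<in> R k" if "k < r" for k using that not_less_Least unfolding r_def by blast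
        have "\<not> r \<le> n" using Rdec[of r n] x(1) \<open>x \<notin> R r\<close> by blast
        then obtain s where s: "r = Suc s" "n \<le> s" by (cases r) simp_all
        have xs: "x \<in> R s" using least s by simp
        have xX: "x \<in> topspace X" using x(1) unfolding R_def by blast
        obtain g where g: "g \<in> ?P r" "act g x \<notin> D" using \<open>x \<notin> R r\<close> xX unfolding R_def by blast
        have gc: "g \<in> carrier G" using g Psub by blast
        \<comment> \<open>A shortest escape word \<open>g = c h\<close> sees the whole ball of radius \<open>m\<close> around its tail \<open>h\<close> inside \<open>D\<close>.\<close>
        have "act g x \<in> Q m" if "m \<le> n" for m
        proof -
          \<comment> \<open>Since \<open>m <= n <= s\<close>, the truncated subtraction is exact:
            \<open>c\<close> takes the \<open>Suc m\<close> leftmost letters of \<open>g\<close>,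
            and \<open>h\<close> the other \<open>s - m\<close>.\<close>
          have "r = Suc m + (s - m)" using s that by simp
          then obtain c h where ch: "c \<in> ?P (Suc m)" "h \<in> ?P (s - m)" "g = c \<otimes> h"
            using g(1) set_power_add[OF \<Gamma>sub, of "Suc m" "s - m"] unfolding set_mult_def by auto
          have car: "c \<in> carrier G" "h \<in> carrier G" using ch Psub by blast+
          have hx: "act (inv c) (act g x) = act h x"
            unfolding ch(3) using car xX act_mult act_inv act_closed by simp
          have "act k (act h x) \<in> D" if k: "k \<in> ?P m" for k
          proof -
            \<comment> \<open>This product has length \<open>s\<close>, one less than
              \<open>r\<close>, so it cannot move \<open>x\<close> out of \<open>D\<close>.\<close>
            have "k \<otimes> h \<in> ?P (m + (s - m))"
              unfolding set_power_add[OF \<Gamma>sub] using k ch(2) by (auto simp: set_mult_def)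
            then have "act (k \<otimes> h) x \<in> D" using xs s \<open>m \<le> n\<close> unfolding R_def by simp
            moreover have "k \<in> carrier G" using k Psub by blast
            ultimately show ?thesis using car xX act_mult by simp
          qed
          then have "act (inv c) (act g x) \<in> R m"
            unfolding hx R_def using act_closed[OF car(2) xX] by simp
          then show ?thesis
            unfolding Q_def using inv_set_power[OF \<Gamma>sub \<Gamma>(3) ch(1)] act_closed[OF gc xX] by blast
        qed
        then have "act g x \<in> C n" unfolding C_def using g(2) act_closed[OF gc xX] by simp
        then show ?thesis by auto
      qed
    qed
    then obtain y where y: "y \<in> (\<Inter>n. C n)" by (meson equals0I)
    have yX: "y \<in> topspace X" "y \<notin> D" using y unfolding C_def by auto
    have yQ: "y \<in> Q m" for m
    proof -
      have "y \<in> C m" using y by simp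
      then show ?thesis unfolding C_def by simp
    qed
    let ?O = "X closure_of ((\<lambda>g. act g y) ` carrier G)"
    \<comment> \<open>The orbit of \<open>y\<close> meets each \<open>R m\<close>, possibly at a
      different point each time. A second compactness argument, inside the orbit closure, gives one
      point common to all \<open>R m\<close>.\<close>
    have "(\<Inter>m. ?O \<inter> R m) \<noteq> {}"
    proof (rule compact_space_imp_nest[OF compact_phase])
      show "closedin X (?O \<inter> R m)" for m using Rclosed by (intro closedin_Int closedin_closure_of)
      show "decseq (\<lambda>m. ?O \<inter> R m)" unfolding decseq_def using Rdec by (intro allI impI Int_mono order_refl)
      show "?O \<inter> R m \<noteq> {}" for m
      proof -
        obtain c where c: "c \<in> ?P (Suc m)" "act c y \<in> R m" using yQ[of m] unfolding Q_def by blast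
        have "(\<lambda>g. act g y) ` carrier G \<subseteq> ?O"
          using act_closed yX(1) by (intro closure_of_subset image_subsetI)
        then show ?thesis using c Psub by blast
      qed
    qed
    then obtain z where "z \<in> (\<Inter>m. ?O \<inter> R m)" by (meson equals0I)
    then have z: "z \<in> ?O" "z \<in> R'" unfolding R'_iff by simp_all
    \<comment> \<open>The orbit of \<open>z\<close> stays in the closed set \<open>D\<close>, and
      \<open>sym\<close> puts \<open>y\<close>, which lies outside \<open>D\<close>, into the
      closure of that orbit.\<close>
    have "y \<in> X closure_of ((\<lambda>g. act g z) ` carrier G)" using sym[OF yX(1) z(1)] .
    also have "\<dots> \<subseteq> D" using z(2) D(2) unfolding R'_def by (intro closure_of_minimal) auto
    finally show False using yX by blast
  qed
  then show ?thesis using Ropen R'_def by metis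
qed

end

section \<open>The enveloping semigroup of a distal flow\<close>

text \<open>The Ellis-Numakura lemma. Let \<open>M\<close> be a minimal closed subsemigroup and
  \<open>s\<close> in \<open>M\<close>. Then \<open>M s\<close> is again one inside
  \<open>M\<close>, so \<open>M s = M\<close>. Hence the \<open>t\<close> in \<open>M\<close> with
  \<open>t s = s\<close> form a nonempty closed subsemigroup, which is all of \<open>M\<close>, and
  \<open>s s = s\<close>.\<close>

lemma compact_semigroup_idempotent:
  fixes mult :: "'a \<Rightarrow> 'a \<Rightarrow> 'a" (infixl "\<cdot>" 70)
  assumes comp: "compactin F S" and ne: "S \<noteq> {}" and H: "Hausdorff_space F"
    and closed: "\<And>s t. s \<in> S \<Longrightarrow> t \<in> S \<Longrightarrow> s \<cdot> t \<in> S"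
    and assoc: "\<And>r s t. r \<in> S \<Longrightarrow> s \<in> S \<Longrightarrow> t \<in> S \<Longrightarrow> r \<cdot> s \<cdot> t = r \<cdot> (s \<cdot> t)"
    and cont: "\<And>s. s \<in> S \<Longrightarrow> continuous_map (subtopology F S) F (\<lambda>t. t \<cdot> s)"
  obtains u where "u \<in> S" "u \<cdot> u = u"
proof -
  define sub where "sub C \<longleftrightarrow> C \<noteq> {} \<and> closedin F C \<and> C \<subseteq> S \<and> (\<forall>s\<in>C. \<forall>t\<in>C. s \<cdot> t \<in> C)" for C
  have Sclosed: "closedin F S" using compactin_imp_closedin[OF H comp] .
  \<comment> \<open>Zorn's lemma yields maximal sets, so it is applied to the complements
    \<open>B\<close> of the closed subsemigroups.\<close>
  have "\<exists>B\<in>{B. B \<subseteq> S \<and> sub (S - B)}. \<forall>B'\<in>{B. B \<subseteq> S \<and> sub (S - B)}. B \<subseteq> B' \<longrightarrow> B' = B"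
  proof (rule subset_Zorn_nonempty)
    have "sub S" unfolding sub_def using ne Sclosed closed by simp
    then have "{} \<in> {B. B \<subseteq> S \<and> sub (S - B)}" by simp
    then show "{B. B \<subseteq> S \<and> sub (S - B)} \<noteq> {}" by blast
  next
    fix c assume c: "c \<noteq> {}" "subset.chain {B. B \<subseteq> S \<and> sub (S - B)} c"
    then have csub: "B \<subseteq> S" "sub (S - B)" if "B \<in> c" for B
      using that unfolding subset.chain_def by blast+
    have "S \<inter> \<Inter>((\<lambda>B. S - B) ` c) \<noteq> {}"
    proof (rule comp[unfolded compactin_fip, THEN conjunct2, rule_format], intro conjI ballI allI impI)
      fix C assume "C \<in> (\<lambda>B. S - B) ` c"
      then show "closedin F C" using csub unfolding sub_def by auto
    next
      fix \<F> assume "finite \<F> \<and> \<F> \<subseteq> (\<lambda>B. S - B) ` c"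
      then obtain c' where c': "finite c'" "c' \<subseteq> c" "\<F> = (\<lambda>B. S - B) ` c'"
        by (meson finite_subset_image)
      show "S \<inter> \<Inter>\<F> \<noteq> {}"
      proof (cases "c' = {}")
        case True
        then show ?thesis using c' ne by simp
      next
        case False
        have "subset.chain c c'" using c(2) c'(2) unfolding subset_chain_def by blast
        \<comment> \<open>A nonempty finite chain contains its union, so the finite intersection is
          itself one of the nonempty subsemigroups.\<close>
        then have "\<Union>c' \<in> c" using Union_in_chain[OF c'(1) False] c'(2) by blast
        then have "S - \<Union>c' \<noteq> {}" using csub(2) unfolding sub_def by simp
        then show ?thesis unfolding c'(3) by blast
      qed
    qed
    then have "S - \<Union>c \<noteq> {}" by blast
    moreover have "closedin F (S - \<Union>c)"
    proof -
      have "closedin F (\<Inter>B\<in>c. S - B)"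
        using c(1) csub(2) unfolding sub_def by (intro closedin_INT) auto
      moreover have "(\<Inter>B\<in>c. S - B) = S - \<Union>c" using c(1) by blast
      ultimately show ?thesis by simp
    qed
    moreover have "s \<cdot> t \<in> S - \<Union>c" if st: "s \<in> S - \<Union>c" "t \<in> S - \<Union>c" for s t
    proof -
      have "s \<cdot> t \<in> S - B" if "B \<in> c" for B
        using csub(2)[OF that] st that unfolding sub_def by blast
      then show ?thesis using c(1) by blast
    qed
    ultimately have "sub (S - \<Union>c)" unfolding sub_def by blast
    then show "\<Union>c \<in> {B. B \<subseteq> S \<and> sub (S - B)}" using csub(1) by blast
  qed
  then obtain B where "B \<in> {B. B \<subseteq> S \<and> sub (S - B)}"
    and Bmax: "\<forall>B'\<in>{B. B \<subseteq> S \<and> sub (S - B)}. B \<subseteq> B' \<longrightarrow> B' = B"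
    by (elim bexE)
  then have B: "B \<subseteq> S" "sub (S - B)" by simp_all
  define M where "M = S - B"
  have M: "M \<noteq> {}" "closedin F M" "M \<subseteq> S" "\<And>s t. s \<in> M \<Longrightarrow> t \<in> M \<Longrightarrow> s \<cdot> t \<in> M"
    using B(2) unfolding M_def sub_def by blast+
  have min: "C = M" if "sub C" "C \<subseteq> M" for C
  proof -
    have "S - (S - C) = C" using that(2) M(3) by blast
    moreover have "B \<subseteq> S - C" using that(2) B(1) unfolding M_def by blast
    ultimately have "S - C = B" using Bmax[rule_format, of "S - C"] that(1) by simp
    then show ?thesis using \<open>S - (S - C) = C\<close> unfolding M_def by blast
  qed
  obtain s where s: "s \<in> M" using M(1) by blast
  then have sS: "s \<in> S" using M(3) by blast
  have "compactin F M" using closed_compactin[OF comp M(3,2)] .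
  have contM: "continuous_map (subtopology F M) F (\<lambda>t. t \<cdot> s)"
    using continuous_map_from_subtopology_mono[OF cont[OF sS] M(3)] .
  have "sub ((\<lambda>t. t \<cdot> s) ` M)"
    unfolding sub_def
  proof (intro conjI ballI)
    show "(\<lambda>t. t \<cdot> s) ` M \<noteq> {}" using M(1) by blast
    have "compactin (subtopology F M) M" using \<open>compactin F M\<close> by (simp add: compactin_subtopology)
    from image_compactin[OF this contM] show "closedin F ((\<lambda>t. t \<cdot> s) ` M)"
      by (rule compactin_imp_closedin[OF H])
    show "(\<lambda>t. t \<cdot> s) ` M \<subseteq> S" using M(3) closed sS by blast
    fix x y assume "x \<in> (\<lambda>t. t \<cdot> s) ` M" "y \<in> (\<lambda>t. t \<cdot> s) ` M"
    then obtain a b where ab: "a \<in> M" "b \<in> M" "x = a \<cdot> s" "y = b \<cdot> s" by blast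
    have "a \<cdot> s \<cdot> b \<in> M" using M(4) ab s by blast
    moreover have "a \<cdot> s \<in> S" "b \<in> S" using M(3,4) ab s by blast+
    then have "x \<cdot> y = a \<cdot> s \<cdot> b \<cdot> s" unfolding ab using assoc sS by simp
    ultimately show "x \<cdot> y \<in> (\<lambda>t. t \<cdot> s) ` M" by blast
  qed
  moreover have "(\<lambda>t. t \<cdot> s) ` M \<subseteq> M" using M(4) s by blast
  ultimately have Ms: "(\<lambda>t. t \<cdot> s) ` M = M" by (rule min)
  define W where "W = {t \<in> M. t \<cdot> s = s}"
  have "sub W"
    unfolding sub_def
  proof (intro conjI ballI)
    have "s \<in> (\<lambda>t. t \<cdot> s) ` M" using Ms s by simp
    then show "W \<noteq> {}" unfolding W_def by (elim imageE) auto
    have "closedin F {s}" using closedin_Hausdorff_singleton[OF H] closedin_subset[OF M(2)] s by blast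
    from closedin_continuous_map_preimage[OF contM this]
    have "closedin (subtopology F M) {t \<in> topspace (subtopology F M). t \<cdot> s \<in> {s}}" .
    moreover have "{t \<in> topspace (subtopology F M). t \<cdot> s \<in> {s}} = W"
      unfolding W_def using closedin_subset[OF M(2)] by auto
    ultimately have "closedin (subtopology F M) W" by simp
    then show "closedin F W" using closedin_closed_subtopology[OF M(2)] by blast
    show "W \<subseteq> S" unfolding W_def using M(3) by blast
    fix x y assume xy: "x \<in> W" "y \<in> W"
    then have "x \<in> S" "y \<in> S" using M(3) unfolding W_def by blast+
    then have "x \<cdot> y \<cdot> s = s" using assoc sS xy unfolding W_def by simp
    then show "x \<cdot> y \<in> W" using xy M(4) unfolding W_def by simp
  qed
  moreover have "W \<subseteq> M" unfolding W_def by blast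
  ultimately have "W = M" by (rule min)
  then have "s \<cdot> s = s" using s unfolding W_def by blast
  then show thesis using that sS by blast
qed

section \<open>Enveloping semigroup and orbit closures\<close>

context compact_flow
begin

text \<open>The topology of pointwise convergence. Its points are extensional functions, which is
  why \<open>restrict\<close> and \<open>compose\<close> replace the bare action and plain
  composition below.\<close>

abbreviation (input) "self_maps \<equiv> product_topology (\<lambda>_. X) (topspace X)"

definition act_maps :: "('x \<Rightarrow> 'x) set" where
  "act_maps = (\<lambda>g. restrict (act g) (topspace X)) ` carrier G"

definition enveloping_semigroup :: "('x \<Rightarrow> 'x) set" where
  "enveloping_semigroup = self_maps closure_of act_maps"

lemma act_maps_subset: "act_maps \<subseteq> topspace self_maps"
  unfolding act_maps_def using act_closed by auto

lemma closedin_enveloping_semigroup: "closedin self_maps enveloping_semigroup"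
  unfolding enveloping_semigroup_def by simp

lemma act_maps_subset_enveloping_semigroup: "act_maps \<subseteq> enveloping_semigroup"
  unfolding enveloping_semigroup_def by (rule closure_of_subset[OF act_maps_subset])

lemma compactin_enveloping_semigroup: "compactin self_maps enveloping_semigroup"
proof (rule closedin_compact_space[OF _ closedin_enveloping_semigroup])
  show "compact_space self_maps" using compact_phase by (simp add: compact_space_product_topology)
qed

lemma enveloping_semigroup_PiE: "enveloping_semigroup \<subseteq> topspace X \<rightarrow>\<^sub>E topspace X"
  using closedin_subset[OF closedin_enveloping_semigroup] by simp

text \<open>Evaluating the composite at \<open>x\<close> is the coordinate projection at
  \<open>q x\<close>. Continuity of \<open>q\<close> does not enter, which matters because limits of
  the maps \<open>act g\<close> can be discontinuous.\<close>

lemma continuous_map_compose_right: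
  assumes "q \<in> topspace X \<rightarrow> topspace X"
  shows "continuous_map self_maps self_maps (\<lambda>p. compose (topspace X) p q)"
  unfolding continuous_map_componentwise
proof (intro conjI ballI)
  show "(\<lambda>p. compose (topspace X) p q) ` topspace self_maps \<subseteq> extensional (topspace X)"
    by (auto simp: compose_extensional)
  fix x assume x: "x \<in> topspace X"
  then have "continuous_map self_maps X (\<lambda>p. p (q x))"
    using assms by (intro continuous_map_product_projection) auto
  then show "continuous_map self_maps X (\<lambda>p. compose (topspace X) p q x)"
    using x by (simp add: compose_eq)
qed

text \<open>First half of closure under composition: left translation by the continuous map
  \<open>act g\<close> is continuous and preserves \<open>act_maps\<close>, hence also its
  closure.\<close>

lemma enveloping_semigroup_act:
  assumes g: "g \<in> carrier G" and q: "q \<in> enveloping_semigroup"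
  shows "compose (topspace X) (restrict (act g) (topspace X)) q \<in> enveloping_semigroup"
proof -
  define L where "L q = compose (topspace X) (restrict (act g) (topspace X)) q" for q
  have "continuous_map self_maps self_maps L"
    unfolding continuous_map_componentwise
  proof (intro conjI ballI)
    show "L ` topspace self_maps \<subseteq> extensional (topspace X)" by (auto simp: L_def compose_extensional)
    fix x assume x: "x \<in> topspace X"
    have "continuous_map self_maps X (\<lambda>q. act g (q x))"
      using continuous_map_compose[OF continuous_map_product_projection[OF x] continuous_map_act_point[OF g]]
      by (simp add: o_def)
    then show "continuous_map self_maps X (\<lambda>q. L q x)"
    proof (rule continuous_map_eq)
      fix q assume "q \<in> topspace self_maps"
      then have "q x \<in> topspace X" using x by auto
      then show "act g (q x) = L q x" using x by (simp add: L_def compose_eq)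
    qed
  qed
  from continuous_map_image_closure_subset[OF this, of act_maps]
  have "L q \<in> self_maps closure_of (L ` act_maps)" using q unfolding enveloping_semigroup_def by blast
  moreover have "L ` act_maps \<subseteq> act_maps"
  proof (rule image_subsetI)
    fix p assume "p \<in> act_maps"
    then obtain h where h: "h \<in> carrier G" "p = restrict (act h) (topspace X)"
      unfolding act_maps_def by blast
    have "L p = restrict (act (g \<otimes> h)) (topspace X)"
      unfolding L_def h compose_def using g h(1) act_mult act_closed by (auto simp: restrict_def)
    then show "L p \<in> act_maps" unfolding act_maps_def using g h(1) by blast
  qed
  ultimately show ?thesis
    unfolding L_def enveloping_semigroup_def using closure_of_mono by blast
qed

text \<open>Second half: for fixed \<open>q\<close>, right translation is continuous and sends
  \<open>act_maps\<close> into the closed set \<open>enveloping_semigroup\<close>.\<close>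

lemma enveloping_semigroup_compose:
  assumes p: "p \<in> enveloping_semigroup" and q: "q \<in> enveloping_semigroup"
  shows "compose (topspace X) p q \<in> enveloping_semigroup"
proof -
  let ?R = "\<lambda>p. compose (topspace X) p q"
  have "q \<in> topspace X \<rightarrow> topspace X" using q enveloping_semigroup_PiE by blast
  from continuous_map_image_closure_subset[OF continuous_map_compose_right[OF this], of act_maps]
  have "?R p \<in> self_maps closure_of (?R ` act_maps)" using p unfolding enveloping_semigroup_def by blast
  also have "\<dots> \<subseteq> enveloping_semigroup"
  proof (rule closure_of_minimal[OF _ closedin_enveloping_semigroup])
    show "?R ` act_maps \<subseteq> enveloping_semigroup"
      unfolding act_maps_def using enveloping_semigroup_act q by blast
  qed
  finally show ?thesis .
qed

text \<open>Evaluation at the pair is continuous, so the image of the compact semigroup is closed.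
  This turns questions on orbit closures into algebra.\<close>

lemma orbit_closure_pair:
  assumes x: "x \<in> topspace X" and y: "y \<in> topspace X"
  shows "prod_topology X X closure_of ((\<lambda>g. (act g x, act g y)) ` carrier G) = (\<lambda>p. (p x, p y)) ` enveloping_semigroup"
proof
  let ?ev = "\<lambda>p. (p x, p y)"
  have cont: "continuous_map self_maps (prod_topology X X) ?ev"
    using x y by (intro continuous_map_pairedI continuous_map_product_projection)
  have ev: "?ev ` act_maps = (\<lambda>g. (act g x, act g y)) ` carrier G"
    unfolding act_maps_def image_image using x y by simp
  show "?ev ` enveloping_semigroup \<subseteq> prod_topology X X closure_of ((\<lambda>g. (act g x, act g y)) ` carrier G)"
    using continuous_map_image_closure_subset[OF cont, of act_maps]
    unfolding ev enveloping_semigroup_def .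
  have "Hausdorff_space (prod_topology X X)"
    using Hausdorff_phase by (simp add: Hausdorff_space_prod_topology)
  then have "closedin (prod_topology X X) (?ev ` enveloping_semigroup)"
    using image_compactin[OF compactin_enveloping_semigroup cont] by (rule compactin_imp_closedin)
  moreover have "(\<lambda>g. (act g x, act g y)) ` carrier G \<subseteq> ?ev ` enveloping_semigroup"
    unfolding ev[symmetric] by (rule image_mono[OF act_maps_subset_enveloping_semigroup])
  ultimately show "prod_topology X X closure_of ((\<lambda>g. (act g x, act g y)) ` carrier G) \<subseteq> ?ev ` enveloping_semigroup"
    by (intro closure_of_minimal)
qed

text \<open>An idempotent \<open>u\<close> sends both \<open>x\<close> and \<open>u x\<close> to
  \<open>u x\<close>, so the orbit closure of this pair meets the diagonal.\<close>

lemma distal_idempotent_eq_id: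
  assumes "distal_flow G X act" and u: "u \<in> enveloping_semigroup" "compose (topspace X) u u = u" and x: "x \<in> topspace X"
  shows "u x = x"
proof (rule ccontr)
  assume neq: "u x \<noteq> x"
  have ux: "u x \<in> topspace X" using u(1) x enveloping_semigroup_PiE by blast
  have "u (u x) = u x" using compose_eq[OF x, of u u] u(2) by simp
  then have "(u x, u x) \<in> prod_topology X X closure_of ((\<lambda>g. (act g x, act g (u x))) ` carrier G)"
    unfolding orbit_closure_pair[OF x ux] using u(1) by (metis (mono_tags, lifting) image_eqI)
  moreover have "(u x, u x) \<in> Id_on (topspace X)" using ux by blast
  ultimately show False
    using assms(1)[unfolded distal_flow_def, rule_format, OF x ux neq[symmetric]] by auto
qed

text \<open>The right translate of the semigroup by \<open>p\<close> is a compact semigroup. It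
  contains an idempotent, of the form \<open>q\<close> after \<open>p\<close>, and by distality this
  is the identity.\<close>

lemma distal_left_inverse:
  assumes "distal_flow G X act" and p: "p \<in> enveloping_semigroup"
  obtains q where "q \<in> enveloping_semigroup" "\<And>x. x \<in> topspace X \<Longrightarrow> q (p x) = x"
proof -
  let ?S = "topspace X"
  let ?R = "\<lambda>q. compose ?S q p"
  have pS: "p \<in> ?S \<rightarrow> ?S" using p enveloping_semigroup_PiE by blast
  have RE: "?R ` enveloping_semigroup \<subseteq> enveloping_semigroup" using enveloping_semigroup_compose p by blast
  obtain u where u: "u \<in> ?R ` enveloping_semigroup" "compose ?S u u = u"
  proof (rule compact_semigroup_idempotent[of self_maps "?R ` enveloping_semigroup" "compose ?S"])
    show "compactin self_maps (?R ` enveloping_semigroup)"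
      using image_compactin[OF compactin_enveloping_semigroup continuous_map_compose_right[OF pS]] .
    show "?R ` enveloping_semigroup \<noteq> {}" using p by blast
    show "Hausdorff_space self_maps" using Hausdorff_phase by (simp add: Hausdorff_space_product_topology)
    show "compose ?S s t \<in> ?R ` enveloping_semigroup" if st: "s \<in> ?R ` enveloping_semigroup" "t \<in> ?R ` enveloping_semigroup" for s t
    proof -
      obtain a b where ab: "a \<in> enveloping_semigroup" "b \<in> enveloping_semigroup" "s = ?R a" "t = ?R b" using st by blast
      have "compose ?S s b \<in> enveloping_semigroup" using enveloping_semigroup_compose RE st(1) ab(2) by blast
      moreover have "compose ?S s t = ?R (compose ?S s b)"
        unfolding ab(4) by (rule compose_assoc[OF pS])
      ultimately show ?thesis by blast
    qed
    show "compose ?S (compose ?S r s) t = compose ?S r (compose ?S s t)" if "t \<in> ?R ` enveloping_semigroup" for r s t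
    proof -
      have "t \<in> ?S \<rightarrow> ?S" using that RE enveloping_semigroup_PiE by blast
      then show ?thesis by (rule compose_assoc[symmetric])
    qed
    show "continuous_map (subtopology self_maps (?R ` enveloping_semigroup)) self_maps (\<lambda>t. compose ?S t s)" if "s \<in> ?R ` enveloping_semigroup" for s
    proof -
      have "s \<in> ?S \<rightarrow> ?S" using that RE enveloping_semigroup_PiE by blast
      then show ?thesis
        by (intro continuous_map_from_subtopology continuous_map_compose_right)
    qed
  qed
  then obtain q where q: "q \<in> enveloping_semigroup" "u = ?R q" by blast
  have "q (p x) = x" if x: "x \<in> ?S" for x
    using distal_idempotent_eq_id[OF assms(1) _ u(2) x] RE u(1) compose_eq[OF x, of q p] q(2) by auto
  then show thesis using that q(1) by blast
qed

text \<open>If \<open>p\<close> carries \<open>(x, y)\<close> to \<open>(z, w)\<close>, a left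
  inverse of \<open>p\<close> carries it back. This supplies \<open>sym\<close> of
  \<open>openin_invariant_core\<close> for the product flow.\<close>

lemma distal_orbit_closure_sym:
  assumes "distal_flow G X act" and x: "x \<in> topspace X" and y: "y \<in> topspace X"
    and zw: "(z, w) \<in> prod_topology X X closure_of ((\<lambda>g. (act g x, act g y)) ` carrier G)"
  shows "(x, y) \<in> prod_topology X X closure_of ((\<lambda>g. (act g z, act g w)) ` carrier G)"
proof -
  obtain p where p: "p \<in> enveloping_semigroup" "z = p x" "w = p y"
    using zw unfolding orbit_closure_pair[OF x y] by blast
  then have zw': "z \<in> topspace X" "w \<in> topspace X" using x y enveloping_semigroup_PiE by blast+
  obtain q where q: "q \<in> enveloping_semigroup" "\<And>x. x \<in> topspace X \<Longrightarrow> q (p x) = x"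
    using distal_left_inverse[OF assms(1) p(1)] by blast
  show ?thesis
    unfolding orbit_closure_pair[OF zw'] by (rule image_eqI[OF _ q(1)]) (simp add: q(2) p x y)
qed

end

section \<open>Finite factors\<close>

context compact_flow
begin

lemma discrete_flow_equicontinuous:
  assumes "X = discrete_topology Q"
  shows "equicontinuous_flow G X act"
  unfolding equicontinuous_flow_def
proof (intro ballI)
  fix y \<epsilon> assume y: "y \<in> topspace X" and "\<epsilon> \<in> the_uniformity X"
  then have "Id_on (topspace X) \<subseteq> \<epsilon>"
    unfolding the_uniformity_compact_Hausdorff(2)[OF compact_phase Hausdorff_phase] diagonal_nbhds_def
    by blast
  then have "\<forall>g\<in>carrier G. act g ` {y} \<subseteq> \<epsilon> `` {act g y}" using act_closed y by blast
  moreover have "nbhd_in X y {y}" unfolding nbhd_in_def using y assms by auto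
  ultimately show "\<exists>U. nbhd_in X y U \<and> (\<forall>g\<in>carrier G. act g ` U \<subseteq> \<epsilon> `` {act g y})" by blast
qed

text \<open>A compact discrete space is finite, so the kernel \<open>N\<close> of the action has
  finite index. It serves every point and every neighborhood at once.\<close>

lemma discrete_flow_regularly_almost_periodic:
  assumes "X = discrete_topology Q"
  shows "pointwise_regularly_almost_periodic G T X act"
proof -
  let ?S = "topspace X"
  define N where "N = {t \<in> carrier G. \<forall>y\<in>?S. act t y = y}"
  have fixing: "act (inv g) y = y" if "g \<in> N" "y \<in> ?S" for g y
    using that act_inv(1)[of g y] unfolding N_def by simp
  have "subgroup N G"
  proof
    show "N \<subseteq> carrier G" unfolding N_def by blast
    show "\<one> \<in> N" unfolding N_def using act_one by simp
    show "x \<otimes> y \<in> N" if "x \<in> N" "y \<in> N" for x y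
      using that unfolding N_def by (simp add: act_mult)
    show "inv x \<in> N" if "x \<in> N" for x
      using that fixing[OF that] unfolding N_def by simp
  qed
  then have normal: "N \<lhd> G"
  proof (rule normal_invI)
    fix x h assume x: "x \<in> carrier G" and h: "h \<in> N"
    have "act (x \<otimes> h \<otimes> inv x) y = y" if y: "y \<in> ?S" for y
    proof -
      have "act h (act (inv x) y) = act (inv x) y" using h act_closed x y unfolding N_def by simp
      then show ?thesis using x h y act_closed unfolding N_def by (simp add: act_mult act_inv)
    qed
    then show "x \<otimes> h \<otimes> inv x \<in> N" using x h unfolding N_def by simp
  qed
  have "finite ?S" using compact_phase assms by (simp add: compact_space_discrete_topology)
  define f where "f g = restrict (act g) ?S" for g
  have "f ` carrier G \<subseteq> ?S \<rightarrow>\<^sub>E ?S" unfolding f_def using act_closed by auto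
  then have "finite (f ` carrier G)" using \<open>finite ?S\<close> finite_PiE finite_subset by metis
  \<comment> \<open>\<open>K\<close> contains a representative for each of the finitely many maps
    \<open>f g\<close>, hence for each coset of \<open>N\<close>.\<close>
  then obtain K where K: "K \<subseteq> carrier G" "finite K" "f ` carrier G = f ` K"
    by (meson finite_subset_image order_refl)
  have "syndetic G T N"
    unfolding syndetic_def
  proof (intro conjI exI)
    show "N \<subseteq> carrier G" unfolding N_def by blast
    \<comment> \<open>The definition of \<open>syndetic\<close> inverts its compact set, so the
      witness is \<open>set_inv K\<close> and the two inversions cancel.\<close>
    have inv_sub: "set_inv K \<subseteq> carrier G" using K(1) unfolding SET_INV_def by auto
    moreover have "finite (set_inv K)" using K(2) unfolding SET_INV_def by blast
    ultimately show "compactin T (set_inv K)"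
      using topspace_eq_carrier by (simp add: finite_imp_compactin)
    have "set_inv (set_inv K) = K"
    proof -
      have "inv (inv k) = k" if "k \<in> K" for k using that K(1) by auto
      then show ?thesis unfolding SET_INV_def by auto
    qed
    moreover have "carrier G = K <#> N"
    proof
      show "K <#> N \<subseteq> carrier G" using K(1) unfolding N_def set_mult_def by auto
      show "carrier G \<subseteq> K <#> N"
      proof
        fix g assume g: "g \<in> carrier G"
        then obtain k where k: "k \<in> K" "f g = f k" using K(3) by (metis image_iff)
        have kc: "k \<in> carrier G" using k K by blast
        have "act (inv k \<otimes> g) y = y" if y: "y \<in> ?S" for y
        proof -
          have "act g y = act k y" using fun_cong[OF k(2), of y] y unfolding f_def by simp
          then show ?thesis using kc g y by (simp add: act_mult act_inv)
        qed
        then have "inv k \<otimes> g \<in> N" unfolding N_def using kc g by simp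
        moreover have "g = k \<otimes> (inv k \<otimes> g)" using kc g by (simp add: m_assoc[symmetric])
        ultimately show "g \<in> K <#> N" using k(1) unfolding set_mult_def by blast
      qed
    qed
    ultimately show "carrier G = set_inv (set_inv K) <#> N" by simp
  qed
  moreover have "N \<subseteq> {t \<in> carrier G. act t y \<in> U}" if "y \<in> ?S" "nbhd_in X y U" for y U
    using that unfolding N_def nbhd_in_def by auto
  ultimately show ?thesis
    unfolding pointwise_regularly_almost_periodic_def regularly_almost_periodic_point_def
    using normal by blast
qed

lemma pair_flow: "compact_flow G T (prod_topology X X) (\<lambda>g (x, y). (act g x, act g y))"
proof (intro compact_flow.intro compact_flow_axioms.intro Hausdorff_paratopological_group_axioms)
  show "compact_space (prod_topology X X)" using compact_phase by (simp add: compact_space_prod_topology)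
  show "Hausdorff_space (prod_topology X X)" using Hausdorff_phase by (simp add: Hausdorff_space_prod_topology)
  let ?P = "prod_topology T (prod_topology X X)"
  have "continuous_map ?P (prod_topology T X) (\<lambda>p. (fst p, fst (snd p)))"
    by (intro continuous_map_pairedI continuous_map_fst continuous_map_fst_of continuous_map_snd
        continuous_map_compose[OF continuous_map_snd continuous_map_fst, unfolded o_def])
  note 1 = continuous_map_compose[OF this continuous_act]
  have "continuous_map ?P (prod_topology T X) (\<lambda>p. (fst p, snd (snd p)))"
    by (intro continuous_map_pairedI continuous_map_fst
        continuous_map_compose[OF continuous_map_snd continuous_map_snd, unfolded o_def])
  note 2 = continuous_map_compose[OF this continuous_act]
  show "continuous_map ?P (prod_topology X X) (\<lambda>(t, z). case z of (x, y) \<Rightarrow> (act t x, act t y))"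
    using continuous_map_pairedI[OF 1 2] by (simp add: o_def case_prod_unfold)
qed (auto simp: act_one act_mult)

text \<open>The relation is the invariant core, in the product flow, of the clopen set
  \<open>D\<close> of pairs that \<open>A\<close> does not separate.\<close>

lemma openin_agreement_relation:
  assumes "compactly_generated G T" and distal: "distal_flow G X act"
    and A: "openin X A" "closedin X A"
  shows "openin (prod_topology X X) {(x, y). x \<in> topspace X \<and> y \<in> topspace X \<and>
           (\<forall>g\<in>carrier G. act g x \<in> A \<longleftrightarrow> act g y \<in> A)}" (is "openin _ ?R")
proof -
  define D where "D = A \<times> A \<union> (topspace X - A) \<times> (topspace X - A)"
  interpret pair: compact_flow G T "prod_topology X X" "\<lambda>g (x, y). (act g x, act g y)"
    by (rule pair_flow)
  have "openin (prod_topology X X) {p \<in> topspace (prod_topology X X).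
          \<forall>g\<in>carrier G. (case p of (x, y) \<Rightarrow> (act g x, act g y)) \<in> D}"
  proof (rule pair.openin_invariant_core[OF assms(1)])
    show "openin (prod_topology X X) D"
      unfolding D_def using A by (intro openin_Un) (auto simp: openin_prod_Times_iff)
    show "closedin (prod_topology X X) D"
      unfolding D_def using A by (intro closedin_Un) (auto simp: closedin_prod_Times_iff)
    show "p \<in> prod_topology X X closure_of ((\<lambda>g. case q of (x, y) \<Rightarrow> (act g x, act g y)) ` carrier G)"
      if "p \<in> topspace (prod_topology X X)"
        "q \<in> prod_topology X X closure_of ((\<lambda>g. case p of (x, y) \<Rightarrow> (act g x, act g y)) ` carrier G)"
      for p q
      using that distal_orbit_closure_sym[OF distal] by (cases p; cases q) auto
  qed
  also have "{p \<in> topspace (prod_topology X X).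
      \<forall>g\<in>carrier G. (case p of (x, y) \<Rightarrow> (act g x, act g y)) \<in> D} = ?R"
    unfolding D_def using act_closed by auto
  finally show ?thesis .
qed

end

section \<open>Quotient by an open invariant equivalence relation, and the main result\<close>

lemma quotient_flow_discrete:
  assumes flow: "compact_flow G T X act"
    and R: "equiv (topspace X) R" "openin (prod_topology X X) R"
    and inv: "\<And>g x y. g \<in> carrier G \<Longrightarrow> (x, y) \<in> R \<Longrightarrow> (act g x, act g y) \<in> R"
  shows "flow_factor G T X act (discrete_topology (topspace X // R)) (\<lambda>g C. act g ` C) (\<lambda>x. R `` {x})"
proof -
  interpret compact_flow G T X act by (rule flow)
  let ?S = "topspace X"
  let ?Q = "?S // R"
  have RS: "R \<subseteq> ?S \<times> ?S" using R(1) equiv_type by blast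
  have cls: "R `` {x} \<in> ?Q" "x \<in> R `` {x}" if "x \<in> ?S" for x
    using quotientI[OF that] equiv_class_self[OF R(1) that] by simp_all
  have open_class: "openin X (R `` {x})" if x: "x \<in> ?S" for x
  proof -
    have "continuous_map X (prod_topology X X) (\<lambda>y. (x, y))"
      using x by (intro continuous_map_pairedI) auto
    from openin_continuous_map_preimage[OF this R(2)]
    have "openin X {y \<in> ?S. (x, y) \<in> R}" .
    moreover have "{y \<in> ?S. (x, y) \<in> R} = R `` {x}" using RS by blast
    ultimately show ?thesis by simp
  qed
  have open_Union: "openin X (\<Union>U)" if "U \<subseteq> ?Q" for U
  proof (rule openin_Union)
    fix C assume "C \<in> U"
    then have "C \<in> ?Q" using that by blast
    then show "openin X C" by (elim quotientE) (use open_class in simp)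
  qed
  \<comment> \<open>Identifies the preimage of \<open>U\<close> under the quotient map with the open
    set \<open>\<Union>U\<close>.\<close>
  have class_mem: "R `` {x} \<in> U \<longleftrightarrow> x \<in> \<Union>U" if U: "U \<subseteq> ?Q" and x: "x \<in> ?S" for U x
  proof
    assume "R `` {x} \<in> U"
    then show "x \<in> \<Union>U" using cls(2)[OF x] by blast
  next
    assume "x \<in> \<Union>U"
    then obtain C where C: "C \<in> U" "x \<in> C" by blast
    then have "C \<in> ?Q" using U by blast
    then have "C = R `` {x}" using C(2) R(1) by (metis equiv_class_eq_iff Image_singleton_iff quotientE)
    then show "R `` {x} \<in> U" using C(1) by simp
  qed
  have act_class: "act g ` (R `` {x}) = R `` {act g x}" if g: "g \<in> carrier G" and x: "x \<in> ?S" for g x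
  proof
    show "act g ` (R `` {x}) \<subseteq> R `` {act g x}" using inv[OF g] by blast
    show "R `` {act g x} \<subseteq> act g ` (R `` {x})"
    proof
      fix y assume "y \<in> R `` {act g x}"
      then have y: "(act g x, y) \<in> R" "y \<in> ?S" using RS by blast+
      have "(act (inv\<^bsub>G\<^esub> g) (act g x), act (inv\<^bsub>G\<^esub> g) y) \<in> R" using inv[OF inv_closed[OF g] y(1)] .
      then have "act (inv\<^bsub>G\<^esub> g) y \<in> R `` {x}" using act_inv(1)[OF g x] by simp
      then show "y \<in> act g ` (R `` {x})" using act_inv(2)[OF g y(2)] by (metis imageI)
    qed
  qed
  obtain F where F: "finite F" "F \<subseteq> ?S" "?S \<subseteq> (\<Union>x\<in>F. R `` {x})"
    using compact_space_finite_subcover[OF compact_phase, of "\<lambda>x. R `` {x}"] open_class cls(2)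
    by blast
  have "?Q \<subseteq> (\<lambda>x. R `` {x}) ` F"
  proof
    fix C assume "C \<in> ?Q"
    then obtain y where y: "y \<in> ?S" "C = R `` {y}" by (elim quotientE)
    then obtain x where x: "x \<in> F" "(x, y) \<in> R" using F(3) by blast
    then have "C = R `` {x}" using y(2) equiv_class_eq[OF R(1)] by simp
    then show "C \<in> (\<lambda>x. R `` {x}) ` F" using x(1) by blast
  qed
  then have "finite ?Q" using F(1) finite_surj by blast
  have "compact_flow G T (discrete_topology ?Q) (\<lambda>g C. act g ` C)"
  proof (intro compact_flow.intro compact_flow_axioms.intro Hausdorff_paratopological_group_axioms)
    show "compact_space (discrete_topology ?Q)"
      using \<open>finite ?Q\<close> by (simp add: compact_space_discrete_topology)
    show "Hausdorff_space (discrete_topology ?Q)" by (rule Hausdorff_space_discrete_topology)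
    show "continuous_map (prod_topology T (discrete_topology ?Q)) (discrete_topology ?Q) (\<lambda>(t, C). act t ` C)"
      unfolding continuous_map_def
    proof (intro conjI allI impI)
      show "(\<lambda>(t, C). act t ` C) \<in> topspace (prod_topology T (discrete_topology ?Q)) \<rightarrow>
              topspace (discrete_topology ?Q)"
      proof
        fix p assume "p \<in> topspace (prod_topology T (discrete_topology ?Q))"
        then obtain t C where p: "p = (t, C)" "t \<in> carrier G" "C \<in> ?Q" using topspace_eq_carrier by auto
        obtain x where x: "x \<in> ?S" "C = R `` {x}" using p(3) by (elim quotientE)
        show "(\<lambda>(t, C). act t ` C) p \<in> topspace (discrete_topology ?Q)"
          unfolding p(1) x(2) using act_class[OF p(2) x(1)] cls(1)[OF act_closed[OF p(2) x(1)]] by simp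
      qed
      fix U assume "openin (discrete_topology ?Q) U"
      then have U: "U \<subseteq> ?Q" by simp
      \<comment> \<open>As the quotient is discrete, joint continuity can be checked on the slices
        with \<open>C\<close> fixed. There it reduces to continuity of \<open>t\<close> acting on
        one representative \<open>x\<close> of \<open>C\<close>.\<close>
      have "openin T {t \<in> carrier G. act t ` C \<in> U}" if C: "C \<in> ?Q" for C
      proof -
        obtain x where x: "x \<in> ?S" "C = R `` {x}" using C by (elim quotientE)
        have "{t \<in> carrier G. act t ` C \<in> U} = {t \<in> topspace T. act t x \<in> \<Union>U}"
          unfolding x(2) topspace_eq_carrier
          using act_class[OF _ x(1)] class_mem[OF U act_closed[OF _ x(1)]] by auto
        then show ?thesis
          using openin_continuous_map_preimage[OF continuous_map_act_group[OF x(1)] open_Union[OF U]]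
          by simp
      qed
      then have "openin (prod_topology T (discrete_topology ?Q))
          (\<Union>C\<in>?Q. {t \<in> carrier G. act t ` C \<in> U} \<times> {C})"
        by (intro openin_Union) (auto simp: openin_prod_Times_iff)
      moreover have "(\<Union>C\<in>?Q. {t \<in> carrier G. act t ` C \<in> U} \<times> {C}) =
          {p \<in> topspace (prod_topology T (discrete_topology ?Q)). (\<lambda>(t, C). act t ` C) p \<in> U}"
        using topspace_eq_carrier by auto
      ultimately show "openin (prod_topology T (discrete_topology ?Q))
          {p \<in> topspace (prod_topology T (discrete_topology ?Q)). (\<lambda>(t, C). act t ` C) p \<in> U}"
        by simp
    qed
    fix C assume "C \<in> topspace (discrete_topology ?Q)"
    then have CS: "C \<subseteq> ?S" using in_quotient_imp_subset[OF R(1)] by simp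
    then have "act \<one>\<^bsub>G\<^esub> y = y" if "y \<in> C" for y using that act_one by blast
    then show "act \<one>\<^bsub>G\<^esub> ` C = C" by simp
    fix s t assume st: "s \<in> carrier G" "t \<in> carrier G"
    show "act (s \<otimes>\<^bsub>G\<^esub> t) ` C = act s ` act t ` C"
      unfolding image_image using act_mult[OF st] CS by (intro image_cong) auto
  qed
  moreover have "continuous_map X (discrete_topology ?Q) (\<lambda>x. R `` {x})"
    unfolding continuous_map_def
  proof (intro conjI allI impI)
    show "(\<lambda>x. R `` {x}) \<in> ?S \<rightarrow> topspace (discrete_topology ?Q)" using cls(1) by simp
    fix U assume "openin (discrete_topology ?Q) U"
    then have U: "U \<subseteq> ?Q" by simp
    have "{x \<in> ?S. R `` {x} \<in> U} = \<Union>U"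
      using class_mem[OF U] openin_subset[OF open_Union[OF U]] by auto
    then show "openin X {x \<in> ?S. R `` {x} \<in> U}" using open_Union[OF U] by simp
  qed
  moreover have "(\<lambda>x. R `` {x}) ` ?S = topspace (discrete_topology ?Q)"
    unfolding quotient_def by auto
  ultimately show ?thesis unfolding flow_factor_def using act_class by simp
qed

theorem mainTheorem3:
  fixes G :: "('g, 'm) monoid_scheme"
    and T :: "'g topology"
    and X :: "'x topology"
    and act :: "'g \<Rightarrow> 'x \<Rightarrow> 'x"
  assumes "compact_flow G T X act"
    and "\<not> connected_space X"
    and "compactly_generated G T"
    and "distal_flow G X act"
  shows "\<exists>(Y :: 'x set topology) act' \<pi>.
           flow_factor G T X act Y act' \<pi> \<and>
           \<not> (\<exists>y. topspace Y = {y}) \<and>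
           equicontinuous_flow G Y act' \<and>
           pointwise_regularly_almost_periodic G T Y act'"
proof -
  interpret compact_flow G T X act by (rule assms(1))
  obtain A where A: "openin X A" "closedin X A" "A \<noteq> {}" "A \<noteq> topspace X"
    using assms(2) unfolding connected_space_clopen_in by blast
  define R where "R = {(x, y). x \<in> topspace X \<and> y \<in> topspace X \<and>
                         (\<forall>g\<in>carrier G. act g x \<in> A \<longleftrightarrow> act g y \<in> A)}"
  let ?Y = "discrete_topology (topspace X // R)"
  have equiv: "equiv (topspace X) R"
    unfolding R_def by (rule equivI) (auto simp: refl_on_def sym_def trans_def)
  have "openin (prod_topology X X) R"
    unfolding R_def using openin_agreement_relation[OF assms(3,4) A(1,2)] .
  moreover have "(act g x, act g y) \<in> R" if g: "g \<in> carrier G" and xy: "(x, y) \<in> R" for g x y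
  proof -
    have S: "x \<in> topspace X" "y \<in> topspace X" using xy unfolding R_def by auto
    have "act h (act g x) \<in> A \<longleftrightarrow> act h (act g y) \<in> A" if "h \<in> carrier G" for h
      using xy that g unfolding act_mult[OF that g S(1), symmetric] act_mult[OF that g S(2), symmetric] R_def
      by simp
    then show ?thesis using S act_closed[OF g] unfolding R_def by simp
  qed
  ultimately have factor: "flow_factor G T X act ?Y (\<lambda>g C. act g ` C) (\<lambda>x. R `` {x})"
    using quotient_flow_discrete[OF assms(1) equiv] by blast
  then have flow: "compact_flow G T ?Y (\<lambda>g C. act g ` C)" unfolding flow_factor_def by blast
  have "topspace ?Y \<noteq> {C}" for C
  proof
    assume C: "topspace ?Y = {C}"
    \<comment> \<open>\<open>A\<close> is nonempty and proper, so it separates some \<open>a\<close>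
      from some \<open>b\<close>; the unit of the group then shows that they lie in different
      classes.\<close>
    obtain a b where ab: "a \<in> A" "b \<in> topspace X" "b \<notin> A" using A(3,4) openin_subset[OF A(1)] by blast
    then have a: "a \<in> topspace X" using openin_subset[OF A(1)] by blast
    have "R `` {a} = R `` {b}" using C quotientI[OF a, of R] quotientI[OF ab(2), of R] by simp
    then have "(a, b) \<in> R" using eq_equiv_class[OF _ equiv ab(2)] by blast
    then have "act \<one>\<^bsub>G\<^esub> a \<in> A \<longleftrightarrow> act \<one>\<^bsub>G\<^esub> b \<in> A" unfolding R_def by simp
    then show False using act_one a ab by simp
  qed
  then show ?thesis
    using factor compact_flow.discrete_flow_equicontinuous[OF flow refl]
      compact_flow.discrete_flow_regularly_almost_periodic[OF flow refl]
    by blast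
qed

end
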